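(* Let $G=\mathrm{Sym}_n$ acting naturally on $\{1,\ldots,n\}$. Define subgroups $H=\mathrm{Stab}(1)=\mathrm{Sym}_{\{2,\ldots,n\}}$ and $T=\mathrm{Stab}(1)\cap\mathrm{Stab}(n)=\mathrm{Sym}_{\{2,\ldots,n-1\}}$. Consider the two-step shuffle of a deck of $n$ cards: remove the bottom card, insert it under a random card chosen uniformly from the remaining deck, then move the top card to the bottom. This shuffle lumps weakly to $G/H$ with stable ideal $\mathbb{C}[G]\eta_T$.
   Context: Positions in the deck are numbered $1$ (top) to $n$ (bottom). Permutations act on positions on the right: after the shuffle $g$, the card in position $j$ is in position $jg$; products compose left to right, $j(gh)=(jg)h$. The shuffle is identified with the normalized weight $w=\sum_gw(g)g\in\mathbb{C}[G]$ where $w(g)$ is the probability that the shuffle is $g$; explicitly $w=\frac{1}{n-1}\sum_{k=1}^{n-1}g_k$, where $g_k$ (inserting the bottom card under the card in position $k$, then moving the top card to the bottom) sends $1\mapsto n$, $j\mapsto j-1$ for $2\le j\le k$, $j\mapsto j$ for $k+1\le j\le n-1$, and $n\mapsto k$. Repeated shuffles form the left-invariant random walk on $G$ in which the step $x\mapsto xg$ has probability $w(g)$. For a subgroup $K$, $\eta_K=|K|^{-1}\sum_{g\in K}g$. For an idempotent $e\in\mathbb{C}[H]$ with $\eta_He=\eta_H$, $w$ lumps weakly to $G/H$ with stable ideal $\mathbb{C}[G]e$ if $ew(1-e)=0$ and $(e-\eta_H)w\eta_H=0$ (a condition depending only on the left ideal $\mathbb{C}[G]e$). *)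

theory Defs
  imports Complex_Main "HOL-Combinatorics.Permutations" "HOL-Algebra.Coset"
begin

section \<open>The group algebra of a finite group\<close>

text \<open>Elements of \<open>\<complex>[G]\<close> are functions to \<open>\<complex>\<close> that vanish outside
  \<open>carrier G\<close>; \<open>\<complex>[K]\<close> for a subset \<open>K\<close> sits inside as the functions that vanish
  outside \<open>K\<close>. Sums and differences are pointwise.\<close>

definition galg :: "'g set \<Rightarrow> ('g \<Rightarrow> complex) set" where
  "galg K = {a. \<forall>g. g \<notin> K \<longrightarrow> a g = 0}"

definition gdelta :: "'g \<Rightarrow> 'g \<Rightarrow> complex" where
  "gdelta x = (\<lambda>g. if g = x then 1 else 0)"

definition gmult ::
  "('g, 'm) monoid_scheme \<Rightarrow> ('g \<Rightarrow> complex) \<Rightarrow> ('g \<Rightarrow> complex) \<Rightarrow> 'g \<Rightarrow> complex"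
  (infixl \<open>\<star>\<index>\<close> 70) where
  "a \<star>\<^bsub>G\<^esub> b =
     (\<lambda>g. \<Sum>x\<in>carrier G. \<Sum>y\<in>carrier G. if x \<otimes>\<^bsub>G\<^esub> y = g then a x * b y else 0)"

definition left_ideal ::
  "('g, 'm) monoid_scheme \<Rightarrow> ('g \<Rightarrow> complex) \<Rightarrow> ('g \<Rightarrow> complex) set" where
  "left_ideal G e = {a \<star>\<^bsub>G\<^esub> e | a. a \<in> galg (carrier G)}"

definition eta :: "'g set \<Rightarrow> 'g \<Rightarrow> complex" where
  "eta K = (\<lambda>g. if g \<in> K then 1 / of_nat (card K) else 0)"

section \<open>Weak lumping\<close>

definition lumping_idempotent ::
  "('g, 'm) monoid_scheme \<Rightarrow> 'g set \<Rightarrow> ('g \<Rightarrow> complex) \<Rightarrow> bool" where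
  "lumping_idempotent G H e \<longleftrightarrow>
     e \<in> galg H \<and> e \<star>\<^bsub>G\<^esub> e = e \<and> eta H \<star>\<^bsub>G\<^esub> e = eta H"

definition lumping_equations ::
  "('g, 'm) monoid_scheme \<Rightarrow> 'g set \<Rightarrow> ('g \<Rightarrow> complex) \<Rightarrow> ('g \<Rightarrow> complex) \<Rightarrow> bool" where
  "lumping_equations G H w e \<longleftrightarrow>
     e \<star>\<^bsub>G\<^esub> w \<star>\<^bsub>G\<^esub> (gdelta \<one>\<^bsub>G\<^esub> - e) = (\<lambda>_. 0) \<and>
     (e - eta H) \<star>\<^bsub>G\<^esub> w \<star>\<^bsub>G\<^esub> eta H = (\<lambda>_. 0)"

text \<open>The choice of the generating idempotent \<open>e\<close> of \<open>L\<close> is immaterial: see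
  \<open>lumps_weakly_left_ideal_iff\<close> below.\<close>

definition lumps_weakly ::
  "('g, 'm) monoid_scheme \<Rightarrow> 'g set \<Rightarrow> ('g \<Rightarrow> complex) \<Rightarrow> ('g \<Rightarrow> complex) set \<Rightarrow> bool" where
  "lumps_weakly G H w L \<longleftrightarrow>
     (\<exists>e. lumping_idempotent G H e \<and> L = left_ideal G e \<and> lumping_equations G H w e)"

context
  fixes G :: "('g, 'm) monoid_scheme" (structure)
  assumes G: "group G" and fin: "finite (carrier G)"
begin

interpretation group G by (rule G)

lemma gmult_assoc: "(a \<star> b) \<star> c = a \<star> (b \<star> c)"
proof
  fix g
  let ?C = "carrier G"
  let ?S = "\<Sum>p\<in>?C. \<Sum>q\<in>?C. \<Sum>k\<in>?C. if (p \<otimes> q) \<otimes> k = g then a p * b q * c k else 0"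
  have "((a \<star> b) \<star> c) g =
     (\<Sum>h\<in>?C. \<Sum>k\<in>?C. \<Sum>p\<in>?C. \<Sum>q\<in>?C.
        if h \<otimes> k = g \<and> p \<otimes> q = h then a p * b q * c k else 0)"
    unfolding gmult_def
    by (intro sum.cong refl) (auto simp: sum_distrib_right intro!: sum.cong)
  also have "\<dots> = (\<Sum>k\<in>?C. \<Sum>p\<in>?C. \<Sum>q\<in>?C. \<Sum>h\<in>?C.
        if h = p \<otimes> q then (if h \<otimes> k = g then a p * b q * c k else 0) else 0)"
    apply (rule trans[OF sum.swap], rule sum.cong[OF refl])
    apply (rule trans[OF sum.swap], rule sum.cong[OF refl])
    apply (rule trans[OF sum.swap], rule sum.cong[OF refl])
    by (rule sum.cong) auto
  also have "\<dots> = (\<Sum>k\<in>?C. \<Sum>p\<in>?C. \<Sum>q\<in>?C.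
        if (p \<otimes> q) \<otimes> k = g then a p * b q * c k else 0)"
    by (intro sum.cong refl) (simp add: sum.delta[OF fin])
  also have "\<dots> = ?S"
    by (rule trans[OF sum.swap], rule sum.cong[OF refl], rule sum.swap)
  finally have 1: "((a \<star> b) \<star> c) g = ?S" .
  have "(a \<star> (b \<star> c)) g =
     (\<Sum>p\<in>?C. \<Sum>h\<in>?C. \<Sum>q\<in>?C. \<Sum>k\<in>?C.
        if p \<otimes> h = g \<and> q \<otimes> k = h then a p * b q * c k else 0)"
    unfolding gmult_def
    by (intro sum.cong refl) (auto simp: sum_distrib_left mult.assoc intro!: sum.cong)
  also have "\<dots> = (\<Sum>p\<in>?C. \<Sum>q\<in>?C. \<Sum>k\<in>?C. \<Sum>h\<in>?C.
        if h = q \<otimes> k then (if p \<otimes> h = g then a p * b q * c k else 0) else 0)"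
    apply (rule sum.cong[OF refl])
    apply (rule trans[OF sum.swap], rule sum.cong[OF refl])
    apply (rule trans[OF sum.swap], rule sum.cong[OF refl])
    by (rule sum.cong) auto
  also have "\<dots> = (\<Sum>p\<in>?C. \<Sum>q\<in>?C. \<Sum>k\<in>?C.
        if p \<otimes> (q \<otimes> k) = g then a p * b q * c k else 0)"
    by (intro sum.cong refl) (simp add: sum.delta[OF fin])
  also have "\<dots> = ?S"
    by (intro sum.cong refl) (simp add: m_assoc)
  finally show "((a \<star> b) \<star> c) g = (a \<star> (b \<star> c)) g" using 1 by simp
qed

lemma gmult_diff_left: "(a - b) \<star> c = a \<star> c - b \<star> c"
  by (rule ext)
    (auto simp: gmult_def left_diff_distrib simp flip: sum_subtractf intro!: sum.cong)

lemma gmult_diff_right: "a \<star> (b - c) = a \<star> b - a \<star> c"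
  by (rule ext)
    (auto simp: gmult_def right_diff_distrib simp flip: sum_subtractf intro!: sum.cong)

lemma gmult_in_galg: "a \<star> b \<in> galg (carrier G)"
  by (auto simp: galg_def gmult_def intro!: sum.neutral)

lemma gmult_gdelta_one_right:
  assumes "a \<in> galg (carrier G)"
  shows "a \<star> gdelta \<one> = a"
proof
  fix g
  have "(a \<star> gdelta \<one>) g =
      (\<Sum>x\<in>carrier G. \<Sum>y\<in>carrier G. if y = \<one> then (if x \<otimes> y = g then a x else 0) else 0)"
    unfolding gmult_def gdelta_def by (intro sum.cong refl) auto
  also have "\<dots> = (\<Sum>x\<in>carrier G. if x = g then a x else 0)"
    by (intro sum.cong refl) (simp add: sum.delta[OF fin])
  also have "\<dots> = a g"
    using assms by (simp add: sum.delta[OF fin] galg_def)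
  finally show "(a \<star> gdelta \<one>) g = a g" .
qed

lemma galg_subset: "K \<subseteq> M \<Longrightarrow> a \<in> galg K \<Longrightarrow> a \<in> galg M"
  by (auto simp: galg_def)

lemma eta_in_galg: "eta K \<in> galg K"
  by (auto simp: galg_def eta_def)

text \<open>For \<open>e \<in> \<complex>[H]\<close> both \<open>e \<eta>\<^sub>H\<close> and \<open>\<eta>\<^sub>H e\<close> are the coefficient sum of
  \<open>e\<close> times \<open>\<eta>\<^sub>H\<close>.\<close>

lemma gmult_eta_right:
  assumes H: "subgroup H G" and e: "e \<in> galg H"
  shows "(e \<star> eta H) g = sum e H * eta H g"
proof -
  note HC = subgroup.subset[OF H]
  have "(e \<star> eta H) g =
      (\<Sum>x\<in>H. \<Sum>y\<in>carrier G. if x \<otimes> y = g then e x * eta H y else 0)"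
    unfolding gmult_def using e
    by (intro sum.mono_neutral_right[OF fin HC]) (auto simp: galg_def intro!: sum.neutral)
  also have "\<dots> = (\<Sum>x\<in>H. e x * eta H g)"
  proof (intro sum.cong refl)
    fix x assume x: "x \<in> H"
    hence xC: "x \<in> carrier G" using HC by auto
    show "(\<Sum>y\<in>carrier G. if x \<otimes> y = g then e x * eta H y else 0) = e x * eta H g"
    proof (cases "g \<in> carrier G")
      case True
      have "(\<Sum>y\<in>carrier G. if x \<otimes> y = g then e x * eta H y else 0) =
         (\<Sum>y\<in>carrier G. if y = inv x \<otimes> g then e x * eta H y else 0)"
        using xC True by (intro sum.cong refl) (auto simp: inv_solve_left)
      also have "\<dots> = e x * eta H (inv x \<otimes> g)"
        using xC True by (simp add: sum.delta[OF fin])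
      also have "inv x \<otimes> g \<in> H \<longleftrightarrow> g \<in> H"
      proof
        assume "inv x \<otimes> g \<in> H"
        hence "x \<otimes> (inv x \<otimes> g) \<in> H" by (rule subgroup.m_closed[OF H x])
        thus "g \<in> H" using xC True by (simp flip: m_assoc)
      next
        assume "g \<in> H"
        thus "inv x \<otimes> g \<in> H"
          by (intro subgroup.m_closed[OF H] subgroup.m_inv_closed[OF H] x)
      qed
      hence "eta H (inv x \<otimes> g) = eta H g" by (simp add: eta_def)
      finally show ?thesis .
    next
      case False
      hence "eta H g = 0" using HC by (auto simp: eta_def)
      thus ?thesis using False xC by (auto intro!: sum.neutral)
    qed
  qed
  finally show ?thesis by (simp add: sum_distrib_right)
qed

lemma gmult_eta_left:
  assumes H: "subgroup H G" and e: "e \<in> galg H"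
  shows "(eta H \<star> e) g = sum e H * eta H g"
proof -
  note HC = subgroup.subset[OF H]
  have "(eta H \<star> e) g =
      (\<Sum>y\<in>carrier G. \<Sum>x\<in>carrier G. if x \<otimes> y = g then eta H x * e y else 0)"
    unfolding gmult_def by (rule sum.swap)
  also have "\<dots> = (\<Sum>y\<in>H. \<Sum>x\<in>carrier G. if x \<otimes> y = g then eta H x * e y else 0)"
    using e
    by (intro sum.mono_neutral_right[OF fin HC]) (auto simp: galg_def intro!: sum.neutral)
  also have "\<dots> = (\<Sum>y\<in>H. e y * eta H g)"
  proof (intro sum.cong refl)
    fix y assume y: "y \<in> H"
    hence yC: "y \<in> carrier G" using HC by auto
    show "(\<Sum>x\<in>carrier G. if x \<otimes> y = g then eta H x * e y else 0) = e y * eta H g"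
    proof (cases "g \<in> carrier G")
      case True
      have "(\<Sum>x\<in>carrier G. if x \<otimes> y = g then eta H x * e y else 0) =
         (\<Sum>x\<in>carrier G. if x = g \<otimes> inv y then eta H x * e y else 0)"
        using yC True by (intro sum.cong refl) (auto simp: inv_solve_right)
      also have "\<dots> = eta H (g \<otimes> inv y) * e y"
        using yC True by (simp add: sum.delta[OF fin])
      also have "g \<otimes> inv y \<in> H \<longleftrightarrow> g \<in> H"
      proof
        assume "g \<otimes> inv y \<in> H"
        hence "(g \<otimes> inv y) \<otimes> y \<in> H" by (rule subgroup.m_closed[OF H _ y])
        thus "g \<in> H" using yC True by (simp add: m_assoc)
      next
        assume "g \<in> H"
        thus "g \<otimes> inv y \<in> H"
          by (intro subgroup.m_closed[OF H] subgroup.m_inv_closed[OF H] y)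
      qed
      hence "eta H (g \<otimes> inv y) = eta H g" by (simp add: eta_def)
      finally show ?thesis by (simp add: mult.commute)
    next
      case False
      hence "eta H g = 0" using HC by (auto simp: eta_def)
      thus ?thesis using False yC by (auto intro!: sum.neutral)
    qed
  qed
  finally show ?thesis by (simp add: sum_distrib_right)
qed

lemma lumping_equations_iff:
  "lumping_equations G H w e \<longleftrightarrow>
     e \<star> w \<star> e = e \<star> w \<and> e \<star> w \<star> eta H = eta H \<star> w \<star> eta H"
proof -
  have "e \<star> w \<star> (gdelta \<one> - e) = e \<star> w - e \<star> w \<star> e"
    by (simp add: gmult_diff_right gmult_gdelta_one_right gmult_in_galg)
  moreover have "(e - eta H) \<star> w \<star> eta H = e \<star> w \<star> eta H - eta H \<star> w \<star> eta H"
    by (simp add: gmult_diff_left)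
  ultimately show ?thesis
    unfolding lumping_equations_def by (auto simp: fun_eq_iff)
qed

lemma lumping_equations_left_ideal_cong:
  assumes H: "subgroup H G"
    and e: "lumping_idempotent G H e" and f: "lumping_idempotent G H f"
    and ideal: "left_ideal G e = left_ideal G f"
    and eqs: "lumping_equations G H w e"
  shows "lumping_equations G H w f"
proof -
  note HC = subgroup.subset[OF H]
  have right_id: "x \<star> u = x" if "lumping_idempotent G H u" "x \<in> left_ideal G u" for x u
    using that by (auto simp: left_ideal_def lumping_idempotent_def gmult_assoc)
  have mem: "u \<in> left_ideal G u" if "lumping_idempotent G H u" for u
    using that galg_subset[OF HC, of u] unfolding left_ideal_def lumping_idempotent_def
    by (metis (mono_tags, lifting) mem_Collect_eq)
  have ef: "e \<star> f = e" using right_id[OF f] mem[OF e] ideal by simp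
  have fe: "f \<star> e = f" using right_id[OF e] mem[OF f] ideal by simp
  have "f \<star> eta H = eta H \<star> f"
    using f gmult_eta_left[OF H] gmult_eta_right[OF H]
    by (auto simp: lumping_idempotent_def fun_eq_iff)
  hence fH: "f \<star> eta H = eta H" using f by (simp add: lumping_idempotent_def)
  have 1: "e \<star> w \<star> e = e \<star> w" and 2: "e \<star> w \<star> eta H = eta H \<star> w \<star> eta H"
    using eqs by (auto simp: lumping_equations_iff)
  have fw: "f \<star> w = f \<star> w \<star> e"
    by (metis 1 fe gmult_assoc)
  have "f \<star> w \<star> f = f \<star> w" by (metis fw ef gmult_assoc)
  moreover have "f \<star> w \<star> eta H = eta H \<star> w \<star> eta H"
    by (metis 2 fe fH gmult_assoc)
  ultimately show ?thesis by (simp add: lumping_equations_iff)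
qed

theorem lumps_weakly_left_ideal_iff:
  assumes "subgroup H G" and "lumping_idempotent G H e"
  shows "lumps_weakly G H w (left_ideal G e) \<longleftrightarrow> lumping_equations G H w e"
  using assms lumping_equations_left_ideal_cong unfolding lumps_weakly_def by metis

end

section \<open>The shuffle\<close>

text \<open>Permutations act on positions on the right, so the product \<open>g h\<close> applies \<open>g\<close>
  first. This is the opposite of the convention of \<open>sym_group\<close> in \<open>HOL-Algebra\<close>.\<close>

definition Sym :: "nat \<Rightarrow> (nat \<Rightarrow> nat) monoid" where
  "Sym n = \<lparr>carrier = {g. g permutes {1..n}}, mult = (\<lambda>g h. h \<circ> g), one = id\<rparr>"

definition Stab :: "nat \<Rightarrow> nat \<Rightarrow> (nat \<Rightarrow> nat) set" where
  "Stab n i = {g \<in> carrier (Sym n). g i = i}"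

definition shuffle_perm :: "nat \<Rightarrow> nat \<Rightarrow> nat \<Rightarrow> nat" where
  "shuffle_perm n k j =
     (if j = 1 then n
      else if 2 \<le> j \<and> j \<le> k then j - 1
      else if j = n then k
      else j)"

definition shuffle_weight :: "nat \<Rightarrow> (nat \<Rightarrow> nat) \<Rightarrow> complex" where
  "shuffle_weight n =
     (\<lambda>g. (1 / of_nat (n - 1)) * (\<Sum>k = 1..n - 1. gdelta (shuffle_perm n k) g))"

text \<open>The two steps of the shuffle: insert the bottom card under the card in position
  \<open>k\<close>, then move the top card to the bottom.\<close>

definition insert_bottom_under :: "nat \<Rightarrow> nat \<Rightarrow> nat \<Rightarrow> nat" where
  "insert_bottom_under n k j =
     (if k < j \<and> j < n then j + 1 else if j = n then k + 1 else j)"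

definition top_to_bottom :: "nat \<Rightarrow> nat \<Rightarrow> nat" where
  "top_to_bottom n j = (if j = 1 then n else if 2 \<le> j \<and> j \<le> n then j - 1 else j)"

lemma shuffle_perm_two_steps:
  assumes "1 \<le> k" "k \<le> n - 1"
  shows "shuffle_perm n k = insert_bottom_under n k \<otimes>\<^bsub>Sym n\<^esub> top_to_bottom n"
  using assms
  by (auto simp: fun_eq_iff Sym_def shuffle_perm_def insert_bottom_under_def top_to_bottom_def)

lemma group_Sym: "group (Sym n)"
proof (rule groupI)
  fix x assume "x \<in> carrier (Sym n)"
  thus "\<exists>y\<in>carrier (Sym n). y \<otimes>\<^bsub>Sym n\<^esub> x = \<one>\<^bsub>Sym n\<^esub>"
    by (auto simp: Sym_def intro!: bexI[of _ "inv_into UNIV x"]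
        permutes_inv permutes_inv_o)
qed (auto simp: Sym_def permutes_compose permutes_id o_assoc)

lemma finite_carrier_Sym: "finite (carrier (Sym n))"
  by (simp add: Sym_def finite_permutations)

lemma shuffle_perm_in_Sym:
  assumes "1 \<le> k" "k \<le> n - 1"
  shows "shuffle_perm n k \<in> carrier (Sym n)"
proof -
  have "inj_on (shuffle_perm n k) {1..n}"
    using assms by (auto simp: inj_on_def shuffle_perm_def split: if_splits)
  moreover have "shuffle_perm n k ` {1..n} \<subseteq> {1..n}"
    using assms by (auto simp: shuffle_perm_def)
  ultimately have "bij_betw (shuffle_perm n k) {1..n} {1..n}"
    by (simp add: bij_betw_def endo_inj_surj)
  thus ?thesis
    using assms by (auto simp: Sym_def shuffle_perm_def intro!: bij_imp_permutes)
qed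

end

theory Submission
  imports Defs
begin

text \<open>Write \<open>e = \<eta>\<^sub>T\<close>. The coset \<open>T g\<close> consists of the permutations that agree with
  \<open>g\<close> at the positions \<open>1\<close> and \<open>n\<close>. The \<open>k\<close>-th term \<open>g\<^sub>k\<close> of the shuffle sends
  \<open>1\<close> to \<open>n\<close> and \<open>n\<close> to \<open>k\<close>, and \<open>k\<close> takes each of the values
  \<open>1, \<dots>, n - 1\<close> once, so the cosets \<open>T g\<^sub>k\<close> partition \<open>{g. 1g = n}\<close>. Hence \<open>e w\<close> is the
  uniform distribution on this set (\<open>eta_Stab_gmult_shuffle\<close>): once the cards other
  than the top and bottom ones are in random order, a single shuffle leaves the old top
  card at the bottom and everything above it in random order.

  The condition \<open>1g = n\<close> survives left multiplication of \<open>g\<close> by \<open>H = Stab(1)\<close> and right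
  multiplication by \<open>T \<le> Stab(n)\<close>, so \<open>\<eta>\<^sub>H e w = e w\<close> and \<open>e w e = e w\<close>. The second
  identity is the first lumping equation. As \<open>\<eta>\<^sub>H e = \<eta>\<^sub>H\<close>, the first identity says
  \<open>\<eta>\<^sub>H w = e w\<close>, which gives the second lumping equation even before multiplication
  by \<open>\<eta>\<^sub>H\<close> on the right.\<close>

section \<open>Averaging over a subgroup\<close>

context
  fixes G :: "('g, 'm) monoid_scheme" (structure)
  assumes G: "group G" and fin: "finite (carrier G)"
begin

interpretation group G by (rule G)

lemma gmult_eq_sum_left:
  assumes g: "g \<in> carrier G"
  shows "(a \<star> b) g = (\<Sum>x\<in>carrier G. a x * b (inv x \<otimes> g))"
  unfolding gmult_def
proof (rule sum.cong[OF refl])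
  fix x assume x: "x \<in> carrier G"
  have "(\<Sum>y\<in>carrier G. if x \<otimes> y = g then a x * b y else 0) =
      (\<Sum>y\<in>carrier G. if y = inv x \<otimes> g then a x * b y else 0)"
    using x g by (intro sum.cong refl) (auto simp: inv_solve_left)
  thus "(\<Sum>y\<in>carrier G. if x \<otimes> y = g then a x * b y else 0) = a x * b (inv x \<otimes> g)"
    using x g by (simp add: sum.delta[OF fin])
qed

lemma gmult_eq_sum_right:
  assumes g: "g \<in> carrier G"
  shows "(a \<star> b) g = (\<Sum>y\<in>carrier G. a (g \<otimes> inv y) * b y)"
proof -
  have "(a \<star> b) g = (\<Sum>y\<in>carrier G. \<Sum>x\<in>carrier G. if x \<otimes> y = g then a x * b y else 0)"
    unfolding gmult_def by (rule sum.swap)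
  also have "\<dots> = (\<Sum>y\<in>carrier G. a (g \<otimes> inv y) * b y)"
  proof (rule sum.cong[OF refl])
    fix y assume y: "y \<in> carrier G"
    have "(\<Sum>x\<in>carrier G. if x \<otimes> y = g then a x * b y else 0) =
        (\<Sum>x\<in>carrier G. if x = g \<otimes> inv y then a x * b y else 0)"
      using y g by (intro sum.cong refl) (auto simp: inv_solve_right)
    thus "(\<Sum>x\<in>carrier G. if x \<otimes> y = g then a x * b y else 0) = a (g \<otimes> inv y) * b y"
      using y g by (simp add: sum.delta[OF fin])
  qed
  finally show ?thesis .
qed

lemma sum_eta_carrier:
  assumes K: "subgroup K G"
  shows "sum (eta K) (carrier G) = 1"
proof -
  have "finite K" and "K \<noteq> {}"
    using subgroup.subset[OF K] fin subgroup.one_closed[OF K] by (auto intro: finite_subset)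
  moreover have "sum (eta K) (carrier G) = sum (eta K) K"
    using subgroup.subset[OF K] by (intro sum.mono_neutral_right[OF fin]) (auto simp: eta_def)
  ultimately show ?thesis by (simp add: eta_def)
qed

lemma eta_gmult_left_invariant:
  assumes K: "subgroup K G" and f: "f \<in> galg (carrier G)"
    and inv: "\<And>k g. k \<in> K \<Longrightarrow> g \<in> carrier G \<Longrightarrow> f (k \<otimes> g) = f g"
  shows "eta K \<star> f = f"
proof
  fix g
  show "(eta K \<star> f) g = f g"
  proof (cases "g \<in> carrier G")
    case True
    have "(eta K \<star> f) g = (\<Sum>x\<in>carrier G. eta K x * f g)"
      unfolding gmult_eq_sum_left[OF True]
      using inv[OF subgroup.m_inv_closed[OF K] True]
      by (intro sum.cong refl) (auto simp: eta_def)
    thus ?thesis by (simp add: sum_eta_carrier[OF K] flip: sum_distrib_right)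
  next
    case False
    thus ?thesis using f gmult_in_galg[OF G fin, of "eta K" f] by (auto simp: galg_def)
  qed
qed

lemma gmult_eta_right_invariant:
  assumes K: "subgroup K G" and f: "f \<in> galg (carrier G)"
    and inv: "\<And>k g. k \<in> K \<Longrightarrow> g \<in> carrier G \<Longrightarrow> f (g \<otimes> k) = f g"
  shows "f \<star> eta K = f"
proof
  fix g
  show "(f \<star> eta K) g = f g"
  proof (cases "g \<in> carrier G")
    case True
    have "(f \<star> eta K) g = (\<Sum>y\<in>carrier G. f g * eta K y)"
      unfolding gmult_eq_sum_right[OF True]
      using inv[OF subgroup.m_inv_closed[OF K] True]
      by (intro sum.cong refl) (auto simp: eta_def)
    thus ?thesis by (simp add: sum_eta_carrier[OF K] flip: sum_distrib_left)
  next
    case False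
    thus ?thesis using f gmult_in_galg[OF G fin, of f "eta K"] by (auto simp: galg_def)
  qed
qed

lemma eta_gmult_eta_subgroup:
  assumes H: "subgroup H G" and K: "subgroup K G" and KH: "K \<subseteq> H"
  shows "eta H \<star> eta K = eta H"
proof (rule gmult_eta_right_invariant[OF K])
  show "eta H \<in> galg (carrier G)"
    using subgroup.subset[OF H] by (auto simp: galg_def eta_def)
  fix k g assume k: "k \<in> K" and g: "g \<in> carrier G"
  have kH: "k \<in> H" and kC: "k \<in> carrier G" using k KH subgroup.subset[OF H] by auto
  have "g \<otimes> k \<in> H \<longleftrightarrow> g \<in> H"
  proof
    assume "g \<otimes> k \<in> H"
    hence "(g \<otimes> k) \<otimes> inv k \<in> H"
      by (rule subgroup.m_closed[OF H _ subgroup.m_inv_closed[OF H kH]])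
    thus "g \<in> H" using g kC by (simp add: m_assoc)
  qed (rule subgroup.m_closed[OF H _ kH])
  thus "eta H (g \<otimes> k) = eta H g" by (simp add: eta_def)
qed

end

section \<open>Point stabilizers and the shuffle\<close>

lemma Sym_mult_apply: "(x \<otimes>\<^bsub>Sym n\<^esub> y) i = y (x i)"
  by (simp add: Sym_def)

lemma Sym_one_apply: "\<one>\<^bsub>Sym n\<^esub> i = i"
  by (simp add: Sym_def)

lemma subgroup_Stab: "subgroup (Stab n i) (Sym n)"
proof -
  interpret group "Sym n" by (rule group_Sym)
  show ?thesis
  proof (rule subgroupI)
    show "Stab n i \<subseteq> carrier (Sym n)" by (auto simp: Stab_def)
    show "Stab n i \<noteq> {}"
      by (auto simp: Stab_def Sym_def permutes_id intro!: exI[of _ id])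
    show "a \<otimes>\<^bsub>Sym n\<^esub> b \<in> Stab n i" if "a \<in> Stab n i" "b \<in> Stab n i" for a b
      using that m_closed[of a b] by (auto simp: Stab_def Sym_def)
    fix a assume "a \<in> Stab n i"
    hence a: "a \<in> carrier (Sym n)" and ai: "a i = i" by (auto simp: Stab_def)
    have "(a \<otimes>\<^bsub>Sym n\<^esub> inv\<^bsub>Sym n\<^esub> a) i = i" using a by (simp add: Sym_one_apply)
    hence "(inv\<^bsub>Sym n\<^esub> a) i = i" using ai by (simp add: Sym_mult_apply)
    thus "inv\<^bsub>Sym n\<^esub> a \<in> Stab n i" using a by (simp add: Stab_def)
  qed
qed

text \<open>Since products apply the left factor first, right cosets of a point stabilizer are
  told apart by the image of the point.\<close>

lemma mult_inv_in_Stab_iff: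
  assumes g: "g \<in> carrier (Sym n)" and s: "s \<in> carrier (Sym n)"
  shows "g \<otimes>\<^bsub>Sym n\<^esub> inv\<^bsub>Sym n\<^esub> s \<in> Stab n i \<longleftrightarrow> g i = s i"
proof -
  interpret group "Sym n" by (rule group_Sym)
  let ?y = "g \<otimes>\<^bsub>Sym n\<^esub> inv\<^bsub>Sym n\<^esub> s"
  have y: "?y \<in> carrier (Sym n)" using g s by simp
  have "?y \<otimes>\<^bsub>Sym n\<^esub> s = g" using g s by (simp add: m_assoc)
  hence "g i = s (?y i)" by (metis Sym_mult_apply)
  moreover have "inj s" using s by (auto simp: Sym_def permutes_inj)
  ultimately show ?thesis using y by (auto simp: Stab_def inj_eq)
qed

lemma gmult_shuffle_weight:
  assumes g: "g \<in> carrier (Sym n)"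
  shows "(a \<star>\<^bsub>Sym n\<^esub> shuffle_weight n) g =
    1 / of_nat (n - 1) *
      (\<Sum>k = 1..n - 1. a (g \<otimes>\<^bsub>Sym n\<^esub> inv\<^bsub>Sym n\<^esub> shuffle_perm n k))"
proof -
  let ?C = "carrier (Sym n)"
  let ?a = "\<lambda>y. a (g \<otimes>\<^bsub>Sym n\<^esub> inv\<^bsub>Sym n\<^esub> y)"
  have "(a \<star>\<^bsub>Sym n\<^esub> shuffle_weight n) g =
      (\<Sum>y\<in>?C. \<Sum>k = 1..n - 1. 1 / of_nat (n - 1) * (?a y * gdelta (shuffle_perm n k) y))"
    unfolding gmult_eq_sum_right[OF group_Sym finite_carrier_Sym g] shuffle_weight_def
    by (simp add: sum_distrib_left mult_ac)
  also have "\<dots> =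
      (\<Sum>k = 1..n - 1. \<Sum>y\<in>?C. 1 / of_nat (n - 1) * (?a y * gdelta (shuffle_perm n k) y))"
    by (rule sum.swap)
  also have "\<dots> = (\<Sum>k = 1..n - 1. 1 / of_nat (n - 1) * ?a (shuffle_perm n k))"
  proof (rule sum.cong[OF refl])
    fix k assume "k \<in> {1..n - 1}"
    hence k: "shuffle_perm n k \<in> ?C" by (intro shuffle_perm_in_Sym) auto
    have "(\<Sum>y\<in>?C. 1 / of_nat (n - 1) * (?a y * gdelta (shuffle_perm n k) y)) =
        (\<Sum>y\<in>?C. if y = shuffle_perm n k then 1 / of_nat (n - 1) * ?a y else 0)"
      by (intro sum.cong refl) (simp add: gdelta_def)
    thus "(\<Sum>y\<in>?C. 1 / of_nat (n - 1) * (?a y * gdelta (shuffle_perm n k) y)) =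
        1 / of_nat (n - 1) * ?a (shuffle_perm n k)"
      using k by (simp add: sum.delta[OF finite_carrier_Sym])
  qed
  finally show ?thesis by (simp add: sum_distrib_left)
qed

text \<open>A permutation \<open>g\<close> with \<open>1g = n\<close> has \<open>ng \<noteq> n\<close>, so it lies in exactly one of the cosets
  \<open>T g\<^sub>k\<close>, namely the one with \<open>k = ng\<close>.\<close>

lemma eta_Stab_gmult_shuffle:
  assumes n: "n \<ge> 2" and g: "g \<in> carrier (Sym n)"
  defines "T \<equiv> Stab n 1 \<inter> Stab n n"
  shows "(eta T \<star>\<^bsub>Sym n\<^esub> shuffle_weight n) g =
    (if g 1 = n then 1 / of_nat (n - 1) * (1 / of_nat (card T)) else 0)"
proof -
  have mem: "g \<otimes>\<^bsub>Sym n\<^esub> inv\<^bsub>Sym n\<^esub> shuffle_perm n k \<in> T \<longleftrightarrow> g 1 = n \<and> k = g n"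
    if "k \<in> {1..n - 1}" for k
  proof -
    have s: "shuffle_perm n k \<in> carrier (Sym n)"
      using that by (intro shuffle_perm_in_Sym) auto
    have "shuffle_perm n k 1 = n" "shuffle_perm n k n = k"
      using that n by (auto simp: shuffle_perm_def)
    thus ?thesis
      unfolding T_def Int_iff mult_inv_in_Stab_iff[OF g s] by auto
  qed
  have "(\<Sum>k = 1..n - 1. eta T (g \<otimes>\<^bsub>Sym n\<^esub> inv\<^bsub>Sym n\<^esub> shuffle_perm n k)) =
      (\<Sum>k = 1..n - 1. if k = g n then (if g 1 = n then 1 / of_nat (card T) else 0) else 0)"
    by (intro sum.cong refl) (auto simp: eta_def mem)
  also have "\<dots> = (if g 1 = n then 1 / of_nat (card T) else 0)"
  proof (cases "g 1 = n")
    case True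
    have p: "g permutes {1..n}" using g by (simp add: Sym_def)
    have "g n \<noteq> g 1" using n permutes_inj[OF p] by (auto simp: inj_eq)
    moreover have "g n \<in> {1..n}" using n permutes_in_image[OF p, of n] by auto
    ultimately have "g n \<in> {1..n - 1}" using True by auto
    thus ?thesis by (simp add: sum.delta)
  qed simp
  finally show ?thesis unfolding gmult_shuffle_weight[OF g] by simp
qed

theorem proposition11p3:
  fixes n :: nat
  assumes "n \<ge> 2"
  shows "lumps_weakly (Sym n) (Stab n 1) (shuffle_weight n)
           (left_ideal (Sym n) (eta (Stab n 1 \<inter> Stab n n)))"
proof -
  let ?G = "Sym n" and ?H = "Stab n 1" and ?T = "Stab n 1 \<inter> Stab n n"
  let ?w = "shuffle_weight n"
  let ?ew = "eta ?T \<star>\<^bsub>?G\<^esub> ?w"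
  note Gf = group_Sym[of n] finite_carrier_Sym[of n]
  have H: "subgroup ?H ?G" by (rule subgroup_Stab)
  have T: "subgroup ?T ?G"
    by (intro group.subgroups_Inter_pair[OF group_Sym] subgroup_Stab)
  have closed: "x \<otimes>\<^bsub>?G\<^esub> y \<in> carrier ?G"
    if "x \<in> carrier ?G" "y \<in> carrier ?G" for x y
    using that group_Sym[of n] by (simp add: group.is_monoid monoid.m_closed)
  have ew: "?ew \<in> galg (carrier ?G)" by (rule gmult_in_galg[OF Gf])
  have He: "eta ?H \<star>\<^bsub>?G\<^esub> eta ?T = eta ?H"
    by (rule eta_gmult_eta_subgroup[OF Gf H T]) simp
  have ewe: "?ew \<star>\<^bsub>?G\<^esub> eta ?T = ?ew"
  proof (rule gmult_eta_right_invariant[OF Gf T ew])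
    fix k g assume k: "k \<in> ?T" and g: "g \<in> carrier ?G"
    have kC: "k \<in> carrier ?G" and kn: "k n = n" using k by (auto simp: Stab_def)
    have "inj k" using kC by (auto simp: Sym_def permutes_inj)
    hence "(g \<otimes>\<^bsub>?G\<^esub> k) 1 = n \<longleftrightarrow> g 1 = n"
      using kn by (auto simp: Sym_def dest: injD)
    thus "?ew (g \<otimes>\<^bsub>?G\<^esub> k) = ?ew g"
      by (simp only: eta_Stab_gmult_shuffle[OF assms g]
          eta_Stab_gmult_shuffle[OF assms closed[OF g kC]])
  qed
  have Hew: "eta ?H \<star>\<^bsub>?G\<^esub> ?ew = ?ew"
  proof (rule eta_gmult_left_invariant[OF Gf H ew])
    fix k g assume k: "k \<in> ?H" and g: "g \<in> carrier ?G"
    have kC: "k \<in> carrier ?G" and "k 1 = 1" using k by (auto simp: Stab_def)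
    hence "(k \<otimes>\<^bsub>?G\<^esub> g) 1 = n \<longleftrightarrow> g 1 = n" by (simp add: Sym_def)
    thus "?ew (k \<otimes>\<^bsub>?G\<^esub> g) = ?ew g"
      by (simp only: eta_Stab_gmult_shuffle[OF assms g]
          eta_Stab_gmult_shuffle[OF assms closed[OF kC g]])
  qed
  have "eta ?H \<star>\<^bsub>?G\<^esub> ?w = ?ew"
    using Hew by (simp only: He flip: gmult_assoc[OF Gf])
  hence "lumping_equations ?G ?H ?w (eta ?T)"
    using ewe by (simp add: lumping_equations_iff[OF Gf])
  moreover have "lumping_idempotent ?G ?H (eta ?T)"
    unfolding lumping_idempotent_def
    using He eta_gmult_eta_subgroup[OF Gf T T] by (auto simp: galg_def eta_def)
  ultimately show ?thesis unfolding lumps_weakly_def by blast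
qed

end
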